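(* Fix an integer $n$, $0<\epsilon<1$ and $k\ge1$. Then every $n$-point metric space $X$ contains a subspace $Y\subset X$ which is $(1+\epsilon)$-embeddable in a $k$-increasing space and satisfies \[|Y|\ge\frac{\epsilon}{6\log(12/\epsilon)\log(2k)}\cdot\log n.\]
   Context: For metric spaces $M,X$ and an injective map $f:M\to X$, the distortion is $\mathrm{dist}(f)=\sup_{x\ne y}\frac{d_X(f(x),f(y))}{d_M(x,y)}\cdot\sup_{x\ne y}\frac{d_M(x,y)}{d_X(f(x),f(y))}$; $M$ is $\alpha$-embeddable in $X$ if some $f$ has $\mathrm{dist}(f)\le\alpha$. For $k\ge1$, a $k$-HST is a metric space whose points are the leaves of a finite rooted tree $T$, each vertex $u$ carrying a label $\Delta(u)\ge0$ with $\Delta(u)=0$ iff $u$ is a leaf and $\Delta(u)\le\Delta(v)/k$ whenever $u$ is a child of $v$; the distance between leaves $x,y$ is $\Delta(\mathrm{lca}(x,y))$. A $k$-increasing space is a $k$-HST whose defining tree has the property that every vertex has at most one child which is not a leaf. *)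

theory Defs
  imports "HOL-Analysis.Analysis"
begin

text \<open>The suprema are taken in the extended nonnegative reals, so an unbounded ratio gives the
  value infinity, and the empty suprema (at most one point) are 0; the distortion is then 0.\<close>

definition distortion ::
    "'a set \<Rightarrow> ('a \<Rightarrow> 'a \<Rightarrow> real) \<Rightarrow> ('b \<Rightarrow> 'b \<Rightarrow> real) \<Rightarrow> ('a \<Rightarrow> 'b) \<Rightarrow> ennreal" where
  "distortion M dM dX f =
     (SUP (x, y) \<in> {(x, y). x \<in> M \<and> y \<in> M \<and> x \<noteq> y}. ennreal (dX (f x) (f y) / dM x y)) *
     (SUP (x, y) \<in> {(x, y). x \<in> M \<and> y \<in> M \<and> x \<noteq> y}. ennreal (dM x y / dX (f x) (f y)))"

definition embeddable ::
    "real \<Rightarrow> 'a set \<Rightarrow> ('a \<Rightarrow> 'a \<Rightarrow> real) \<Rightarrow> 'b set \<Rightarrow> ('b \<Rightarrow> 'b \<Rightarrow> real) \<Rightarrow> bool" where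
  "embeddable \<alpha> M dM X dX \<longleftrightarrow>
     (\<exists>f. f ` M \<subseteq> X \<and> inj_on f M \<and> distortion M dM dX f \<le> ennreal \<alpha>)"

text \<open>An edge \<open>(u, v) \<in> E\<close> means that \<open>v\<close> is a child of \<open>u\<close>.\<close>

locale finite_rooted_tree =
  fixes V :: "'v set" and E :: "('v \<times> 'v) set" and root :: 'v
  assumes finite_V: "finite V"
    and edges: "E \<subseteq> V \<times> V"
    and root_in_V: "root \<in> V"
    and root_no_parent: "\<And>u. (u, root) \<notin> E"
    and unique_parent: "\<And>v. v \<in> V \<Longrightarrow> v \<noteq> root \<Longrightarrow> \<exists>!u. (u, v) \<in> E"
    and reachable: "\<And>v. v \<in> V \<Longrightarrow> (root, v) \<in> E\<^sup>*"
begin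

definition leaves :: "'v set" where
  "leaves = {v \<in> V. \<forall>u. (v, u) \<notin> E}"

definition lca :: "'v \<Rightarrow> 'v \<Rightarrow> 'v" where
  "lca x y = (THE w. (w, x) \<in> E\<^sup>* \<and> (w, y) \<in> E\<^sup>* \<and>
                     (\<forall>u. (u, x) \<in> E\<^sup>* \<and> (u, y) \<in> E\<^sup>* \<longrightarrow> (u, w) \<in> E\<^sup>*))"

end

locale k_HST_tree = finite_rooted_tree V E root
  for V :: "'v set" and E root +
  fixes k :: real and \<Delta> :: "'v \<Rightarrow> real"
  assumes k_ge_1: "1 \<le> k"
    and label_nonneg: "\<And>u. u \<in> V \<Longrightarrow> 0 \<le> \<Delta> u"
    and label_zero_iff: "\<And>u. u \<in> V \<Longrightarrow> \<Delta> u = 0 \<longleftrightarrow> u \<in> leaves"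
    and label_child: "\<And>u v. (v, u) \<in> E \<Longrightarrow> \<Delta> u \<le> \<Delta> v / k"

locale k_HST = k_HST_tree V E root k \<Delta> + Metric_space M d
  for V :: "'v set" and E root k \<Delta> and M :: "'v set" and d +
  assumes points: "M = leaves"
    and dist_lca: "\<And>x y. x \<in> M \<Longrightarrow> y \<in> M \<Longrightarrow> d x y = \<Delta> (lca x y)"

locale k_increasing = k_HST V E root k \<Delta> M d
  for V :: "'v set" and E root k \<Delta> and M :: "'v set" and d +
  assumes one_nonleaf_child:
    "\<And>v u w. (v, u) \<in> E \<Longrightarrow> (v, w) \<in> E \<Longrightarrow> u \<notin> leaves \<Longrightarrow> w \<notin> leaves \<Longrightarrow> u = w"

definition k_increasing_space :: "real \<Rightarrow> 'v set \<Rightarrow> ('v \<Rightarrow> 'v \<Rightarrow> real) \<Rightarrow> bool" where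
  "k_increasing_space k M d \<longleftrightarrow> (\<exists>V E root \<Delta>. k_increasing V E root k \<Delta> M d)"

text \<open>The defining trees are finite, so every \<open>k\<close>-increasing space has an isometric copy whose
  tree has natural numbers as vertices. Existence of a target space is therefore expressed over
  the type \<^typ>\<open>nat\<close>; the type of the embedded space may be too small to hold the inner vertices.\<close>

definition embeddable_in_k_increasing ::
    "real \<Rightarrow> real \<Rightarrow> 'a set \<Rightarrow> ('a \<Rightarrow> 'a \<Rightarrow> real) \<Rightarrow> bool" where
  "embeddable_in_k_increasing \<alpha> k M d \<longleftrightarrow>
     (\<exists>(Z :: nat set) dZ. k_increasing_space k Z dZ \<and> embeddable \<alpha> M d Z dZ)"

end

theory Submission
  imports Defs
begin

text \<open>A largest fiber is at least as large as the average one. The product form avoids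
  dividing natural numbers.\<close>

lemma pigeonhole_fiber:
  assumes "finite A" and "finite B" and "B \<noteq> {}" and "g ` A \<subseteq> B"
  shows "\<exists>\<beta>\<in>B. card A \<le> card B * card {x \<in> A. g x = \<beta>}"
proof -
  let ?c = "\<lambda>\<beta>. card {x \<in> A. g x = \<beta>}"
  have "Max (?c ` B) \<in> ?c ` B"
    using assms by (intro Max_in) auto
  then obtain \<beta> where \<beta>: "\<beta> \<in> B" "?c \<beta> = Max (?c ` B)"
    by auto
  have "card A = (\<Sum>y\<in>B. ?c y)"
    using sum.group[OF assms(1,2,4), of "\<lambda>_. 1::nat"] by simp
  also have "\<dots> \<le> card B * ?c \<beta>"
    using sum_bounded_above[of B ?c "?c \<beta>"] \<beta> assms by simp
  finally show ?thesis
    using \<beta> by blast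
qed

section \<open>Caterpillar trees\<close>

text \<open>Vertex \<open>2 * i\<close> is the \<open>i\<close>-th leaf and \<open>2 * j + 1\<close> the \<open>j\<close>-th vertex of the spine, which
  ends at the parent of the leaf \<open>2 * N\<close>. A spine vertex may have no leaf as a child.\<close>

locale caterpillar =
  fixes N :: nat and lev :: "nat \<Rightarrow> nat" and k :: real and W :: "nat \<Rightarrow> real"
  assumes lev_le: "\<And>i. i \<le> N \<Longrightarrow> lev i \<le> lev N"
    and k_ge: "1 \<le> k"
    and W_pos: "\<And>j. 0 < W j"
    and W_Suc: "\<And>j. W (Suc j) \<le> W j / k"
begin

definition verts :: "nat set" where
  "verts = (\<lambda>i. 2 * i) ` {..N} \<union> (\<lambda>j. 2 * j + 1) ` {..lev N}"

definition arcs :: "(nat \<times> nat) set" where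
  "arcs = (\<lambda>j. (2 * j + 1, 2 * Suc j + 1)) ` {..<lev N} \<union> (\<lambda>i. (2 * lev i + 1, 2 * i)) ` {..N}"

definition label :: "nat \<Rightarrow> real" where
  "label v = (if odd v then W (v div 2) else 0)"

definition cdist :: "nat \<Rightarrow> nat \<Rightarrow> real" where
  "cdist x y = (if x = y then 0 else W (min (lev (x div 2)) (lev (y div 2))))"

lemmas parity_neq = Suc_double_not_eq_double double_not_eq_Suc_double

lemma arcs_iff:
  "(u, v) \<in> arcs \<longleftrightarrow>
     (\<exists>j<lev N. u = 2 * j + 1 \<and> v = 2 * Suc j + 1) \<or> (\<exists>i\<le>N. u = 2 * lev i + 1 \<and> v = 2 * i)"
  by (auto simp: arcs_def)

lemma spine_reach: "i \<le> j \<Longrightarrow> j \<le> lev N \<Longrightarrow> (2 * i + 1, 2 * j + 1) \<in> arcs\<^sup>*"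
proof (induction j rule: dec_induct)
  case (step j)
  then have "(2 * j + 1, 2 * Suc j + 1) \<in> arcs"
    using arcs_iff by auto
  with step show ?case
    by (meson Suc_leD rtrancl.rtrancl_into_rtrancl)
qed simp

text \<open>This closed form reduces questions about ancestors to arithmetic and parity:
  reachability from the root and lowest common ancestors are read off from it. The case
  \<open>u = v\<close> also covers numbers outside \<open>verts\<close>.\<close>

lemma reach_iff:
  "(u, v) \<in> arcs\<^sup>* \<longleftrightarrow> u = v \<or>
     (\<exists>j j'. u = 2 * j + 1 \<and> v = 2 * j' + 1 \<and> j \<le> j' \<and> j' \<le> lev N) \<or>
     (\<exists>j i. u = 2 * j + 1 \<and> v = 2 * i \<and> i \<le> N \<and> j \<le> lev i)" (is "_ \<longleftrightarrow> ?R v")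
proof
  assume "(u, v) \<in> arcs\<^sup>*"
  then show "?R v"
  proof (induction rule: rtrancl_induct)
    case (step y z)
    from step.hyps(2) consider j where "j < lev N" "y = 2 * j + 1" "z = 2 * Suc j + 1"
      | i where "i \<le> N" "y = 2 * lev i + 1" "z = 2 * i"
      unfolding arcs_iff by blast
    then show ?case
    proof cases
      case 1
      with step.IH obtain i where "u = 2 * i + 1" "i \<le> j"
        by (auto simp: parity_neq)
      with 1 show ?thesis
        by (intro disjI2 disjI1 exI[of _ i] exI[of _ "Suc j"]) auto
    next
      case 2
      with step.IH lev_le show ?thesis by (auto simp: parity_neq)
    qed
  qed simp
next
  assume "?R v"
  then consider "u = v"
    | j j' where "u = 2 * j + 1" "v = 2 * j' + 1" "j \<le> j'" "j' \<le> lev N"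
    | j i where "u = 2 * j + 1" "v = 2 * i" "i \<le> N" "j \<le> lev i"
    by blast
  then show "(u, v) \<in> arcs\<^sup>*"
  proof cases
    case 3
    then have "(2 * lev i + 1, v) \<in> arcs"
      using arcs_iff by auto
    with 3 show ?thesis
      using spine_reach[of j "lev i"] lev_le by (metis rtrancl.rtrancl_into_rtrancl)
  qed (use spine_reach in auto)
qed

sublocale finite_rooted_tree verts arcs 1
proof
  show "finite verts" "1 \<in> verts"
    by (auto simp: verts_def)
  show "arcs \<subseteq> verts \<times> verts"
    unfolding arcs_def verts_def using lev_le by (fastforce intro: imageI[of "Suc _"])
  show "(u, 1) \<notin> arcs" for u
    by (simp add: arcs_iff parity_neq)
  show "(1, v) \<in> arcs\<^sup>*" if "v \<in> verts" for v
    using that spine_reach unfolding reach_iff verts_def by fastforce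
  show "\<exists>!u. (u, v) \<in> arcs" if v: "v \<in> verts" "v \<noteq> 1" for v
  proof (cases "even v")
    case True
    then obtain i where "v = 2 * i" "i \<le> N"
      using v unfolding verts_def by auto
    moreover have "v \<noteq> 2 * Suc j + 1" for j
      using True by auto
    ultimately show ?thesis
      unfolding arcs_iff by (intro ex1I[of _ "2 * lev i + 1"]) auto
  next
    case False
    then obtain l where l: "v = 2 * l + 1" "l \<le> lev N"
      using v unfolding verts_def by auto
    then obtain j where "l = Suc j"
      using v by (cases l) auto
    moreover have "v \<noteq> 2 * i" for i
      using False by auto
    ultimately show ?thesis
      using l unfolding arcs_iff by (intro ex1I[of _ "2 * j + 1"]) auto
  qed
qed

lemma leaves_eq: "leaves = (\<lambda>i. 2 * i) ` {..N}"
proof (intro equalityI subsetI)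
  fix v assume v: "v \<in> leaves"
  \<comment> \<open>A spine vertex has its successor as a child, and the last one has the leaf
    \<open>2 * N\<close>; so no spine vertex is a leaf.\<close>
  have "\<exists>u. (2 * j + 1, u) \<in> arcs" if "j \<le> lev N" for j
    using that unfolding arcs_iff by (cases "j = lev N") auto
  moreover have "v \<in> verts" "(v, u) \<notin> arcs" for u
    using v by (auto simp: leaves_def)
  ultimately show "v \<in> (\<lambda>i. 2 * i) ` {..N}"
    unfolding verts_def by blast
next
  fix v assume "v \<in> (\<lambda>i. 2 * i) ` {..N}"
  then have "v \<in> verts" "even v"
    unfolding verts_def by auto
  then show "v \<in> leaves"
    unfolding leaves_def arcs_iff by auto
qed

lemma W_antimono: "i \<le> j \<Longrightarrow> W j \<le> W i"
proof (rule lift_Suc_antimono_le[of W])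
  show "W (Suc n) \<le> W n" for n
    using W_Suc[of n] frac_le[of "W n" "W n" 1 k] W_pos[of n] k_ge by simp
qed

text \<open>The common ancestors of two distinct leaves are the spine vertices no deeper than either
  parent. They form a chain, whose deepest member sits at the smaller of the two levels.\<close>

lemma lca_leaf:
  assumes "x \<in> leaves" and "y \<in> leaves"
  shows "lca x y = (if x = y then x else 2 * min (lev (x div 2)) (lev (y div 2)) + 1)"
proof -
  obtain i j where ij: "x = 2 * i" "y = 2 * j" "i \<le> N" "j \<le> N"
    using assms unfolding leaves_eq by auto
  have anc: "(u, 2 * i) \<in> arcs\<^sup>* \<longleftrightarrow> u = 2 * i \<or> (\<exists>l. u = 2 * l + 1 \<and> l \<le> lev i)" if "i \<le> N" for u i
    unfolding reach_iff using that by (auto simp: parity_neq)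
  have anc': "(u, 2 * j + 1) \<in> arcs\<^sup>* \<longleftrightarrow> (\<exists>l. u = 2 * l + 1 \<and> l \<le> j)" if "j \<le> lev N" for u j
    unfolding reach_iff using that by (auto simp: parity_neq)
  have antisym: "u = v" if "(u, v) \<in> arcs\<^sup>*" "(v, u) \<in> arcs\<^sup>*" for u v
    using that unfolding reach_iff by (auto simp: parity_neq)
  \<comment> \<open>\<open>lca\<close> is a definite description; antisymmetry of reachability
    supplies the uniqueness.\<close>
  have lcaI: "lca x y = w" if "(w, x) \<in> arcs\<^sup>*" "(w, y) \<in> arcs\<^sup>*"
    "\<And>u. (u, x) \<in> arcs\<^sup>* \<Longrightarrow> (u, y) \<in> arcs\<^sup>* \<Longrightarrow> (u, w) \<in> arcs\<^sup>*" for w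
    unfolding lca_def by (rule the_equality) (use that antisym in blast)+
  show ?thesis
  proof (cases "x = y")
    case True
    then show ?thesis using lcaI[of x] by simp
  next
    case False
    have "lca x y = 2 * min (lev i) (lev j) + 1"
    proof (rule lcaI)
      fix u assume "(u, x) \<in> arcs\<^sup>*" "(u, y) \<in> arcs\<^sup>*"
      then obtain l where "u = 2 * l + 1" "l \<le> lev i" "l \<le> lev j"
        using False ij anc by (auto simp: parity_neq)
      then show "(u, 2 * min (lev i) (lev j) + 1) \<in> arcs\<^sup>*"
        using anc' lev_le[OF ij(3)] by (simp add: min_def)
    qed (use ij anc in auto)
    with False ij show ?thesis by simp
  qed
qed

text \<open>The vertices that are not leaves form the spine, so the only such child of a spine
  vertex is its successor. Along the spine \<open>W_Suc\<close> gives the label condition; children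
  that are leaves have label 0.\<close>

lemma k_increasing_space_caterpillar: "k_increasing_space k ((\<lambda>i. 2 * i) ` {..N}) cdist"
proof -
  have "k_increasing verts arcs 1 k label leaves cdist"
  proof
    show "0 \<le> label u" for u
      using W_pos by (simp add: label_def less_imp_le)
    show "label u = 0 \<longleftrightarrow> u \<in> leaves" if "u \<in> verts" for u
    proof (cases "even u")
      case True
      then show ?thesis
        using that unfolding leaves_eq by (auto simp: verts_def label_def)
    next
      case False
      then show ?thesis
        using W_pos[of "u div 2"] unfolding leaves_eq by (auto simp: label_def)
    qed
    show "label u \<le> label v / k" if "(v, u) \<in> arcs" for u v
      using that W_Suc W_pos k_ge unfolding arcs_iff label_def
      by (auto simp: less_imp_le)
    show "0 \<le> cdist x y" "cdist x y = cdist y x" for x y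
      using W_pos by (auto simp: cdist_def less_imp_le min.commute)
    show "cdist x y = 0 \<longleftrightarrow> x = y" for x y
      using W_pos by (auto simp: cdist_def less_imp_neq[symmetric])
    show "cdist x z \<le> cdist x y + cdist y z" for x y z
    proof -
      \<comment> \<open>The reason is ultrametric: \<open>min a b\<close> or \<open>min b c\<close>
        is at most \<open>min a c\<close>, and \<open>W\<close> is decreasing.\<close>
      have "W (min a c) \<le> W (min a b) + W (min b c)" for a b c
        using W_antimono[of "min a b" "min a c"] W_antimono[of "min b c" "min a c"]
          W_pos[of "min a b"] W_pos[of "min b c"] by linarith
      then show ?thesis
        using W_pos by (auto simp: cdist_def less_imp_le)
    qed
    show "cdist x y = label (lca x y)" if "x \<in> leaves" "y \<in> leaves" for x y
      using that lca_leaf[OF that] unfolding leaves_eq by (auto simp: cdist_def label_def)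
    show "u = w" if "(v, u) \<in> arcs" "(v, w) \<in> arcs" "u \<notin> leaves" "w \<notin> leaves" for v u w
      using that unfolding arcs_iff leaves_eq by auto
  qed (use k_ge in auto)
  then show ?thesis
    unfolding k_increasing_space_def leaves_eq by blast
qed

end

section \<open>Low-distortion embeddings into caterpillars\<close>

lemma distortion_le:
  assumes "0 \<le> a" and "0 \<le> b"
    and "\<And>x y. x \<in> M \<Longrightarrow> y \<in> M \<Longrightarrow> x \<noteq> y \<Longrightarrow> dX (f x) (f y) / dM x y \<le> a"
    and "\<And>x y. x \<in> M \<Longrightarrow> y \<in> M \<Longrightarrow> x \<noteq> y \<Longrightarrow> dM x y / dX (f x) (f y) \<le> b"
  shows "distortion M dM dX f \<le> ennreal (a * b)"
  unfolding distortion_def ennreal_mult[OF assms(1,2)]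
  by (intro mult_mono SUP_least) (auto intro!: ennreal_leI assms)

text \<open>Hanging each point \<open>x\<close> as a leaf on the spine vertex of index
  \<open>lev x\<close> puts the images of \<open>x\<close> and \<open>y\<close> at distance
  \<open>W (min (lev x) (lev y))\<close>. So the map never expands a distance and shrinks it by a
  factor of at most \<open>\<alpha>\<close>. An empty \<open>Y\<close> is covered as well: the tree
  still has one extra leaf, and \<open>insert 0\<close> keeps the maximum defined.\<close>

lemma embeddable_in_k_increasingI:
  fixes Y :: "'a set" and lev :: "'a \<Rightarrow> nat"
  assumes "finite Y" and "0 \<le> \<alpha>" and "1 \<le> k"
    and W: "\<And>j. 0 < W j" "\<And>j. W (Suc j) \<le> W j / k"
    and d: "\<And>x y. x \<in> Y \<Longrightarrow> y \<in> Y \<Longrightarrow> x \<noteq> y \<Longrightarrow> W (min (lev x) (lev y)) \<le> d x y"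
      "\<And>x y. x \<in> Y \<Longrightarrow> y \<in> Y \<Longrightarrow> x \<noteq> y \<Longrightarrow> d x y \<le> \<alpha> * W (min (lev x) (lev y))"
  shows "embeddable_in_k_increasing \<alpha> k Y d"
proof -
  obtain f where f: "bij_betw f Y {..<card Y}"
    using \<open>finite Y\<close> ex_bij_betw_finite_nat atLeast0LessThan by metis
  define N where "N = card Y"
  have fN: "f x < N" if "x \<in> Y" for x
    using f that unfolding N_def bij_betw_def by blast
  have inj: "inj_on f Y"
    using f bij_betw_def by blast
  txt \<open>The leaf \<open>N\<close> is not the image of a point; it only closes the spine off.\<close>
  define l where "l i = (if i < N then lev (inv_into Y f i) else Max (insert 0 (lev ` Y)))" for i
  have l: "l (f x) = lev x" if "x \<in> Y" for x
    using that fN inj unfolding l_def by simp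
  have "l i \<le> l N" if "i \<le> N" for i
  proof (cases "i < N")
    case True
    then have "inv_into Y f i \<in> Y"
      using f unfolding N_def bij_betw_def by (simp add: inv_into_into)
    then show ?thesis
      using True \<open>finite Y\<close> unfolding l_def by simp
  qed (use that in simp)
  then interpret caterpillar N l k W
    using assms by unfold_locales auto
  let ?g = "\<lambda>x. 2 * f x"
  have cd: "cdist (?g x) (?g y) = W (min (lev x) (lev y))" if "x \<in> Y" "y \<in> Y" "x \<noteq> y" for x y
    using that inj l by (simp add: cdist_def inj_on_eq_iff)
  have "distortion Y d cdist ?g \<le> ennreal (1 * \<alpha>)"
  proof (rule distortion_le)
    fix x y assume xy: "x \<in> Y" "y \<in> Y" "x \<noteq> y"
    note pos = W(1)[of "min (lev x) (lev y)"]
    show "cdist (?g x) (?g y) / d x y \<le> 1"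
      unfolding cd[OF xy] using d(1)[OF xy] pos by simp
    show "d x y / cdist (?g x) (?g y) \<le> \<alpha>"
      unfolding cd[OF xy] using d(2)[OF xy] pos by (simp add: pos_divide_le_eq)
  qed (use \<open>0 \<le> \<alpha>\<close> in auto)
  moreover have "?g ` Y \<subseteq> (\<lambda>i. 2 * i) ` {..N}"
    using fN by (auto intro: less_imp_le)
  moreover have "inj_on ?g Y"
    using inj by (simp add: inj_on_def)
  ultimately show ?thesis
    unfolding embeddable_in_k_increasing_def embeddable_def
    using k_increasing_space_caterpillar by (metis mult_1)
qed

section \<open>Scales of distances\<close>

text \<open>Let \<open>u\<close> and \<open>v\<close> realise the diameter \<open>D\<close>. By the
  triangle inequality every point is at distance at least \<open>D / 2\<close> from \<open>u\<close>
  or from \<open>v\<close>, so one of the two is that far from at least half of the points.\<close>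

lemma (in Metric_space) half_far_from_point:
  assumes "finite S" and "S \<subseteq> M" and "2 \<le> card S"
  obtains x D where "x \<in> S" and "0 < D" and "\<And>u v. u \<in> S \<Longrightarrow> v \<in> S \<Longrightarrow> d u v \<le> D"
    and "card S \<le> 2 * card {z \<in> S. D / 2 \<le> d x z}"
proof -
  let ?P = "(\<lambda>(u, v). d u v) ` (S \<times> S)"
  define D where "D = Max ?P"
  have ne: "S \<noteq> {}" using assms by auto
  have "D \<in> ?P"
    unfolding D_def using assms ne by (intro Max_in) auto
  then obtain u v where uv: "u \<in> S" "v \<in> S" "D = d u v"
    by auto
  have le: "d u v \<le> D" if "u \<in> S" "v \<in> S" for u v
    unfolding D_def using assms that by (intro Max_ge) auto
  obtain a b where "a \<in> S" "b \<in> S" "a \<noteq> b"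
    using assms(1,3) card_le_Suc0_iff_eq[of S] by fastforce
  then have "0 < D"
    using le[of a b] assms(2) mdist_pos_eq[of a b] by fastforce
  have "d u v \<le> d u z + d v z" if "z \<in> S" for z
    using triangle[of u z v] that uv assms(2) commute[of z v] by auto
  then have "S \<subseteq> {z \<in> S. D / 2 \<le> d u z} \<union> {z \<in> S. D / 2 \<le> d v z}"
    using uv(3) by fastforce
  then have "card S \<le> card ({z \<in> S. D / 2 \<le> d u z} \<union> {z \<in> S. D / 2 \<le> d v z})"
    using assms(1) by (intro card_mono) auto
  also have "\<dots> \<le> card {z \<in> S. D / 2 \<le> d u z} + card {z \<in> S. D / 2 \<le> d v z}"
    by (rule card_Un_le)
  finally have "card S \<le> 2 * card {z \<in> S. D / 2 \<le> d u z} \<or> card S \<le> 2 * card {z \<in> S. D / 2 \<le> d v z}"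
    by linarith
  then show thesis
    using that uv(1,2) \<open>0 < D\<close> le by blast
qed

text \<open>The points of \<open>A\<close> are found one after the other, and \<open>b x\<close> is the scale of the distances
  from \<open>x\<close> to all points found later. These scales may increase along the sequence, but only by
  less than \<open>m\<close>, because every distance from \<open>x\<close> is at least half of the diameter of what is left.\<close>

lemma (in Metric_space) ex_subset_one_scale_per_point:
  fixes r m :: real
  assumes r: "1 < r" and m: "log r 2 + 1 \<le> m"
    and S: "finite S" "S \<subseteq> M" "S \<noteq> {}"
  shows "\<exists>A b. A \<subseteq> S \<and>
     (\<forall>x\<in>A. \<forall>y\<in>A. x \<noteq> y \<longrightarrow>
        \<lfloor>log r (d x y)\<rfloor> = b x \<and> b y < b x + m \<or> \<lfloor>log r (d y x)\<rfloor> = b y \<and> b x < b y + m) \<and>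
     (\<forall>x\<in>A. \<exists>y\<in>S. x \<noteq> y \<and> \<lfloor>log r (d x y)\<rfloor> = b x) \<and>
     card S \<le> (2 * (log r 2 + 2)) ^ card A"
  using S
proof (induction "card S" arbitrary: S rule: less_induct)
  case less
  show ?case
  proof (cases "2 \<le> card S")
    case False
    then show ?thesis
      \<comment> \<open>A lone point has no later point to give it a scale, so \<open>A\<close> is
        empty and the bound reads \<open>1 \<le> 1\<close>.\<close>
      by (intro exI[of _ "{}"]) auto
  next
    case True
    obtain x D where x: "x \<in> S" and D: "0 < D" and D_ub: "\<And>u v. u \<in> S \<Longrightarrow> v \<in> S \<Longrightarrow> d u v \<le> D"
      and half: "card S \<le> 2 * card {z \<in> S. D / 2 \<le> d x z}"
      using half_far_from_point[OF less.prems(1,2) True] by blast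
    define F where "F = {z \<in> S. D / 2 \<le> d x z}"
    \<comment> \<open>Distances from \<open>x\<close> to the far half \<open>F\<close> lie between
      \<open>D / 2\<close> and \<open>D\<close>, so only the few scales in \<open>I\<close> occur. A
      most frequent one becomes the scale of \<open>x\<close>, and its fiber \<open>S'\<close> is
      what is left.\<close>
    define I where "I = {\<lfloor>log r (D / 2)\<rfloor>..\<lfloor>log r D\<rfloor>}"
    have log_half: "log r (D / 2) = log r D - log r 2"
      using r D by (simp add: log_divide)
    have "0 < log r 2"
      using r by simp
    then have I: "I \<noteq> {}" "card I \<le> log r 2 + 2"
      unfolding I_def log_half by (auto intro!: floor_mono, linarith)
    have "\<lfloor>log r (d x z)\<rfloor> \<in> I" if "z \<in> F" for z
      using that D D_ub[OF x, of z] r unfolding I_def F_def by (auto intro!: floor_mono)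
    moreover have "finite F"
      using less.prems by (simp add: F_def)
    ultimately obtain \<beta> where \<beta>: "card F \<le> card I * card {z \<in> F. \<lfloor>log r (d x z)\<rfloor> = \<beta>}"
      using pigeonhole_fiber[of F I "\<lambda>z. \<lfloor>log r (d x z)\<rfloor>"] I(1) unfolding I_def by blast
    define S' where "S' = {z \<in> F. \<lfloor>log r (d x z)\<rfloor> = \<beta>}"
    have "x \<notin> S'"
      using x less.prems D by (auto simp: S'_def F_def)
    have S': "S' \<subseteq> S" "finite S'" "S' \<subseteq> M" "card S' < card S"
      using less.prems x \<open>x \<notin> S'\<close> by (auto simp: S'_def F_def intro!: psubset_card_mono)
    have far: "D / 2 \<le> d x z" "\<lfloor>log r (d x z)\<rfloor> = \<beta>" if "z \<in> S'" for z
      using that by (auto simp: S'_def F_def)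
    have card: "card S \<le> 2 * (card I * card S')"
      using half \<beta> unfolding F_def[symmetric] S'_def[symmetric] by linarith
    then have "S' \<noteq> {}"
      using True by auto
    have "real (card S) \<le> real (2 * (card I * card S'))"
      using card by (rule of_nat_mono)
    also have "\<dots> \<le> 2 * ((log r 2 + 2) * card S')"
      using mult_right_mono[OF I(2), of "card S'"] by simp
    finally have card': "card S \<le> 2 * (log r 2 + 2) * card S'"
      by (simp only: mult.assoc)
    obtain A b where A: "A \<subseteq> S'"
      and pairs: "\<forall>x\<in>A. \<forall>y\<in>A. x \<noteq> y \<longrightarrow>
        \<lfloor>log r (d x y)\<rfloor> = b x \<and> b y < b x + m \<or> \<lfloor>log r (d y x)\<rfloor> = b y \<and> b x < b y + m"
      and ex: "\<forall>x\<in>A. \<exists>y\<in>S'. x \<noteq> y \<and> \<lfloor>log r (d x y)\<rfloor> = b x"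
      and cardA: "card S' \<le> (2 * (log r 2 + 2)) ^ card A"
      using less.hyps[OF S'(4,2,3) \<open>S' \<noteq> {}\<close>] by blast
    have "x \<notin> A" "finite A"
      using A \<open>x \<notin> S'\<close> S'(2) finite_subset by auto
    \<comment> \<open>The scale \<open>b y\<close> is realised by a distance within
      \<open>S'\<close>; the realisation clause is carried through the induction for this purpose.
      That distance is at most \<open>D\<close>, hence at most \<open>2 * d x y\<close>. Passing
      from the floor \<open>\<beta>\<close> to \<open>log r (d x y)\<close> costs less than 1, which
      explains the bound \<open>log r 2 + 1 \<le> m\<close>.\<close>
    have scale: "b y < \<beta> + m" if "y \<in> A" for y
    proof -
      obtain z where z: "z \<in> S'" "y \<noteq> z" "\<lfloor>log r (d y z)\<rfloor> = b y"
        using ex \<open>y \<in> A\<close> by blast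
      have y: "y \<in> S'" using A \<open>y \<in> A\<close> by blast
      have "0 < d y z"
        using z y S'(3) mdist_pos_eq by blast
      have "b y \<le> log r (d y z)"
        using z(3) by linarith
      also have "\<dots> \<le> log r D"
        using r \<open>0 < d y z\<close> D_ub S'(1) y z(1) by (simp add: D subset_iff)
      also have "\<dots> \<le> log r (d x y) + log r 2"
        using far(1)[OF y] r D log_half by (smt (verit) log_le_cancel_iff half_gt_zero)
      also have "\<dots> < \<beta> + m"
        using far(2)[OF y] m by linarith
      finally show ?thesis by simp
    qed
    \<comment> \<open>The point \<open>x\<close> comes before all of \<open>A\<close>. The
      disjunction in the pair condition records which of two points came first without an explicit
      order.\<close>
    let ?A = "insert x A" and ?b = "b(x := \<beta>)"
    show ?thesis
    proof (intro exI[of _ ?A] exI[of _ ?b] conjI)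
      show "?A \<subseteq> S"
        using A S' x by auto
      show "\<forall>x\<in>?A. \<forall>y\<in>?A. x \<noteq> y \<longrightarrow>
        \<lfloor>log r (d x y)\<rfloor> = ?b x \<and> ?b y < ?b x + m \<or> \<lfloor>log r (d y x)\<rfloor> = ?b y \<and> ?b x < ?b y + m"
        using pairs scale far(2) A \<open>x \<notin> A\<close> by auto
      show "\<forall>x\<in>?A. \<exists>y\<in>S. x \<noteq> y \<and> \<lfloor>log r (d x y)\<rfloor> = ?b x"
      proof
        fix w assume "w \<in> ?A"
        then consider "w = x" | "w \<in> A" "w \<noteq> x"
          using \<open>x \<notin> A\<close> by auto
        then show "\<exists>y\<in>S. w \<noteq> y \<and> \<lfloor>log r (d w y)\<rfloor> = ?b w"
        proof cases
          case 1
          obtain z where "z \<in> S'" using \<open>S' \<noteq> {}\<close> by blast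
          with 1 far(2)[OF this] S'(1) \<open>x \<notin> S'\<close> show ?thesis
            by (intro bexI[of _ z]) auto
        next
          case 2
          with ex obtain y where "y \<in> S'" "w \<noteq> y" "\<lfloor>log r (d w y)\<rfloor> = b w"
            by blast
          with 2 S'(1) show ?thesis
            by (intro bexI[of _ y]) auto
        qed
      qed
      \<comment> \<open>Each round keeps one point: 2 is lost to the far half, and at most
        \<open>log r 2 + 2\<close> to the choice of a scale.\<close>
      have "card S \<le> 2 * (log r 2 + 2) * (2 * (log r 2 + 2)) ^ card A"
        using card' cardA \<open>0 < log r 2\<close> by (smt (verit) mult_left_mono)
      then show "card S \<le> (2 * (log r 2 + 2)) ^ card ?A"
        using \<open>x \<notin> A\<close> \<open>finite A\<close> by simp
    qed
  qed
qed

text \<open>By concavity \<open>ln\<close> lies above its chord between 1 and 2.\<close>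

lemma ln_one_plus_ge:
  fixes x :: real
  assumes "0 \<le> x" and "x \<le> 1"
  shows "x * ln 2 \<le> ln (1 + x)"
proof -
  have "(1 - x) * ln 1 + x * ln 2 \<le> ln ((1 - x) *\<^sub>R 1 + x *\<^sub>R (2::real))"
    using concave_onD[OF ln_concave, of x 1 2] assms by simp
  then show ?thesis by (simp add: algebra_simps)
qed

text \<open>Scales that are congruent modulo \<open>m\<close> are equal or differ by a factor of at least \<open>r ^ m\<close>,
  hence a residue class of scales gives a space close to an increasing one.\<close>

lemma (in Metric_space) embeddable_congruent_scales:
  fixes r k :: real and m :: nat and b :: "'a \<Rightarrow> int"
  assumes r: "1 < r" and k: "1 \<le> k" "k \<le> r ^ m" and Y: "finite Y" "Y \<subseteq> M" and m: "0 < m"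
    and cong: "\<And>x. x \<in> Y \<Longrightarrow> b x mod m = c"
    and pairs: "\<And>x y. x \<in> Y \<Longrightarrow> y \<in> Y \<Longrightarrow> x \<noteq> y \<Longrightarrow>
      \<lfloor>log r (d x y)\<rfloor> = b x \<and> b y < b x + m \<or> \<lfloor>log r (d y x)\<rfloor> = b y \<and> b x < b y + m"
  shows "embeddable_in_k_increasing r k Y d"
proof -
  obtain q where q: "\<And>x. x \<in> Y \<Longrightarrow> b x div m \<le> q"
    using Y(1) finite_imageI[of Y "\<lambda>x. b x div m"] by (meson Max_ge imageI)
  \<comment> \<open>Levels count downwards from \<open>q\<close>, so that large scales are near the
    root; since \<open>q\<close> bounds all quotients, \<open>nat\<close> truncates nothing.\<close>
  define lev where "lev x = nat (q - b x div m)" for x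
  \<comment> \<open>Going one level down lowers the scale by \<open>m\<close>, which divides the
    label by \<open>r ^ m\<close>, hence by at least \<open>k\<close>.\<close>
  define W where "W j = r powr (of_int c + of_nat m * (of_int q - of_nat j))" for j :: nat
  have div_scale: "b x = c + m * (b x div m)" if "x \<in> Y" for x
    using cong[OF that] mult_div_mod_eq[of "int m" "b x"] by simp
  have W_lev: "W (lev x) = r powr b x" if "x \<in> Y" for x
  proof -
    have "real_of_int (b x) = c + m * (b x div m)"
      by (rule arg_cong[OF div_scale[OF that]])
    then show ?thesis
      using q[OF that] unfolding W_def lev_def by (simp add: algebra_simps)
  qed
  have bounds: "W (min (lev x) (lev y)) \<le> d x y" "d x y \<le> r * W (min (lev x) (lev y))"
    if xy: "x \<in> Y" "y \<in> Y" "x \<noteq> y" and sc: "\<lfloor>log r (d x y)\<rfloor> = b x" "b y < b x + m" for x y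
  proof -
    \<comment> \<open>For scales in one residue class an increase by less than \<open>m\<close> is
      no increase at all. So the earlier point \<open>x\<close> has the smaller level, and the label
      at that level is \<open>r powr b x\<close>.\<close>
    have "b y div m \<le> b x div m"
    proof (rule ccontr)
      assume "\<not> ?thesis"
      then have "m * (b x div m + 1) \<le> m * (b y div m)"
        using m by (intro mult_left_mono) auto
      then have "m * (b x div m) + m \<le> m * (b y div m)"
        by (simp add: distrib_left)
      with sc(2) show False
        using div_scale[OF xy(1)] div_scale[OF xy(2)] by linarith
    qed
    then have "min (lev x) (lev y) = lev x"
      by (simp add: lev_def min_def nat_mono)
    then have W: "W (min (lev x) (lev y)) = r powr b x"
      using W_lev xy by simp
    have pos: "0 < d x y"
      using xy Y(2) mdist_pos_eq by blast
    \<comment> \<open>The floor of the logarithm determines the distance up to a factor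
      \<open>r\<close>, which becomes the distortion.\<close>
    show "W (min (lev x) (lev y)) \<le> d x y"
      unfolding W using sc(1) r pos by (simp add: powr_le_iff flip: le_floor_iff)
    have "d x y = r powr (log r (d x y))"
      using pos r by simp
    also have "\<dots> \<le> r powr (1 + b x)"
      using sc(1) r by (intro powr_mono) linarith+
    finally show "d x y \<le> r * W (min (lev x) (lev y))"
      unfolding W using r by (simp add: powr_add)
  qed
  show ?thesis
  proof (rule embeddable_in_k_increasingI[where W = W and lev = lev])
    show "W (Suc j) \<le> W j / k" for j
    proof -
      have "W j = W (Suc j) * r ^ m"
        using r unfolding W_def
        by (simp add: powr_add[symmetric] powr_realpow[symmetric] algebra_simps)
      then have "W (Suc j) * k \<le> W j"
        using k by (simp add: W_def mult_left_mono)
      then show ?thesis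
        using k by (simp add: pos_le_divide_eq)
    qed
    fix x y assume "x \<in> Y" "y \<in> Y" "x \<noteq> y"
    then show "W (min (lev x) (lev y)) \<le> d x y" "d x y \<le> r * W (min (lev x) (lev y))"
      using pairs[of x y] bounds[of x y] bounds[of y x] by (auto simp: commute min.commute)
  qed (use assms in \<open>auto simp: W_def\<close>)
qed

section \<open>Choice of constants and the final count\<close>

theorem theorem2p1:
  fixes n :: nat and \<epsilon> k :: real
    and X :: "'a set" and d :: "'a \<Rightarrow> 'a \<Rightarrow> real"
  assumes "0 < \<epsilon>" and "\<epsilon> < 1" and "1 \<le> k"
    and "Metric_space X d" and "finite X" and "card X = n"
  shows "\<exists>Y \<subseteq> X. embeddable_in_k_increasing (1 + \<epsilon>) k Y d \<and>
           real (card Y) \<ge> \<epsilon> / (6 * ln (12 / \<epsilon>) * ln (2 * k)) * ln (real n)"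
proof -
  interpret Metric_space X d by fact
  define r where "r = 1 + \<epsilon>"
  have r: "1 < r" using assms by (simp add: r_def)
  \<comment> \<open>Using \<open>2 * k\<close> serves two demands at once:
    \<open>log r 2 + 1 \<le> m\<close> for the selection of \<open>A\<close>, and
    \<open>k \<le> r ^ m\<close> for the labels.\<close>
  define m where "m = nat \<lceil>log r (2 * k)\<rceil> + 1"
  have log2: "0 < log r 2" "log r 2 \<le> log r (2 * k)"
    using r assms by simp_all
  then have m: "log r (2 * k) + 1 \<le> m" "m \<le> log r (2 * k) + 2"
    unfolding m_def by linarith+
  have "log r (2 * k) = log r 2 + log r k"
    using assms by (simp add: log_mult)
  then have "log r k \<le> m"
    using m log2 by linarith
  then have k: "k \<le> r ^ m"
    using r assms by (simp add: log_le_iff powr_realpow)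
  have "0 < m"
    by (simp add: m_def)
  have ln_r: "\<epsilon> * ln 2 \<le> ln r"
    unfolding r_def using assms by (intro ln_one_plus_ge) auto
  have ln2: "(2/3::real) \<le> ln 2"
    using ln2_ge_two_thirds .
  have log_le: "log r t \<le> ln t / (\<epsilon> * ln 2)" if "1 \<le> t" for t
    unfolding log_def using ln_r that assms by (intro divide_left_mono) (auto simp: r_def)
  have ln_2k: "ln 2 \<le> ln (2 * k)"
    using assms by simp
  with ln2 have ln_2k_pos: "0 < ln (2 * k)"
    by linarith
  show ?thesis
  proof (cases "X = {}")
    case True
    \<comment> \<open>The selection of \<open>A\<close> requires a nonempty space. Here
      \<open>n = 0\<close> and \<open>ln 0 = 0\<close> by convention, so the empty subspace
      suffices.\<close>
    have "embeddable_in_k_increasing r k {} d"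
      by (rule embeddable_congruent_scales[where m = m and c = 0])
        (use r assms k \<open>0 < m\<close> in auto)
    then show ?thesis
      using True assms by (auto simp: r_def)
  next
    case False
    then obtain A b where A: "A \<subseteq> X"
      and pairs: "\<forall>x\<in>A. \<forall>y\<in>A. x \<noteq> y \<longrightarrow>
        \<lfloor>log r (d x y)\<rfloor> = b x \<and> b y < b x + real m \<or> \<lfloor>log r (d y x)\<rfloor> = b y \<and> b x < b y + real m"
      and card_A: "n \<le> (2 * (log r 2 + 2)) ^ card A"
      using ex_subset_one_scale_per_point[OF r, of m X] log2 m assms by auto
    have "finite A"
      using A assms finite_subset by blast
    moreover have "(\<lambda>x. b x mod m) ` A \<subseteq> {0..<int m}" "{0..<int m} \<noteq> {}"
      using \<open>0 < m\<close> by auto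
    \<comment> \<open>A most popular residue class of scales loses at most a factor
      \<open>m\<close>.\<close>
    ultimately obtain c where c: "card A \<le> m * card {x \<in> A. b x mod m = c}"
      using pigeonhole_fiber[of A "{0..<int m}" "\<lambda>x. b x mod m"] by auto
    define Y where "Y = {x \<in> A. b x mod m = c}"
    have "\<lfloor>log r (d x y)\<rfloor> = b x \<and> b y < b x + m \<or> \<lfloor>log r (d y x)\<rfloor> = b y \<and> b x < b y + m"
      if "x \<in> Y" "y \<in> Y" "x \<noteq> y" for x y
      using pairs that unfolding Y_def by (smt (verit) mem_Collect_eq of_int_add of_int_less_iff of_int_of_nat_eq)
    then have emb: "embeddable_in_k_increasing r k Y d"
      using r k assms A \<open>finite A\<close>
      by (intro embeddable_congruent_scales[of r k m Y b c]) (auto simp: Y_def m_def)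
    \<comment> \<open>\<open>log_le\<close> gives \<open>log r 2 \<le> 1 / \<epsilon>\<close>, and
      \<open>\<epsilon> < 1\<close> makes the left side at most
      \<open>6 / \<epsilon>\<close>.\<close>
    have "2 * (log r 2 + 2) \<le> 12 / \<epsilon>"
      using log_le[of 2] assms ln2 by (simp add: field_simps)
    then have "(2 * (log r 2 + 2)) ^ card A \<le> (12 / \<epsilon>) ^ card A"
      using log2 by (intro power_mono) auto
    then have "ln n \<le> ln ((12 / \<epsilon>) ^ card A)"
      using card_A False assms by (subst ln_le_cancel_iff) (auto simp: card_gt_0_iff)
    then have ln_n: "ln n \<le> card A * ln (12 / \<epsilon>)"
      using assms by (simp add: ln_realpow)
    have ln_pos: "0 < ln (12 / \<epsilon>)"
      using assms by simp
    have "m \<le> ln (2 * k) / (\<epsilon> * ln 2) + 2"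
      using m(2) log_le[of "2 * k"] assms by linarith
    \<comment> \<open>From \<open>2/3 \<le> ln 2\<close> the two summands are at most 3/2 and 3
      times \<open>ln (2 * k) / \<epsilon>\<close>; their sum stays below the factor 6.\<close>
    also have "\<dots> \<le> 6 * ln (2 * k) / \<epsilon>"
    proof -
      have "ln (2 * k) / (\<epsilon> * ln 2) \<le> ln (2 * k) / (\<epsilon> * (2/3))"
        using ln2 ln_2k assms by (intro divide_left_mono mult_left_mono) auto
      also have "\<dots> = 3/2 * (ln (2 * k) / \<epsilon>)"
        by simp
      finally have "ln (2 * k) / (\<epsilon> * ln 2) \<le> 3/2 * (ln (2 * k) / \<epsilon>)" .
      moreover have "\<epsilon> * 2 \<le> 3 * ln (2 * k)"
        using ln2 ln_2k assms by linarith
      then have "2 \<le> 3 * (ln (2 * k) / \<epsilon>)"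
        using assms(1) by (simp add: field_simps)
      ultimately show ?thesis
        by linarith
    qed
    finally have m_le: "m \<le> 6 * ln (2 * k) / \<epsilon>" .
    have "real (card A) \<le> m * card Y"
      using c unfolding Y_def by (rule of_nat_mono)
    also have "\<dots> \<le> 6 * ln (2 * k) / \<epsilon> * card Y"
      unfolding of_nat_mult using m_le by (intro mult_right_mono) auto
    finally have "ln n \<le> 6 * ln (2 * k) / \<epsilon> * card Y * ln (12 / \<epsilon>)"
      using ln_n ln_pos by (smt (verit) mult_right_mono)
    then have "\<epsilon> / (6 * ln (12 / \<epsilon>) * ln (2 * k)) * ln n \<le> card Y"
      using assms(1) ln_pos ln_2k_pos by (simp add: field_simps)
    moreover have "Y \<subseteq> X"
      using A by (auto simp: Y_def)
    ultimately show ?thesis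
      using emb unfolding r_def by (intro exI[of _ Y]) simp
  qed
qed

end
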